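(* Let $k$ be a positive integer with $k \equiv 0 \pmod 5$ and let \[ n = L_{CC}(10,k) = \frac{512k^5+1280k^4+6400k^3+8000k^2+6250k+3125}{3125}. \] Then there is an undirected Cayley graph of the cyclic group $\mathbb{Z}_n$ on five generators which has diameter $k$. Moreover, a generating set for such a graph is \[ \Big\{1,\ \tfrac{32k^3+40k^2+300k+125}{125},\ \tfrac{128k^4+160k^3+1200k^2-625}{625},\ \tfrac{128k^4+320k^3+1600k^2+1750k+1250}{625},\ \tfrac{256k^4+640k^3+3000k^2+3750k+1250}{625}\Big\}, \] i.e. the Cayley graph of $\mathbb{Z}_n$ with connection set $\{\pm g_1,\dots,\pm g_5\}$, where $g_1,\dots,g_5$ are these integers taken modulo $n$, has diameter $k$.
   Context: For a positive integer $n$ and integers $g_1,\dots,g_5$, the undirected Cayley (circulant) graph of the cyclic group $\mathbb{Z}_n$ with generating set $\{g_1,\dots,g_5\}$ has vertex set $\mathbb{Z}_n$, with $i$ and $j$ adjacent if and only if $j-i \equiv \pm g_t \pmod n$ for some $t$. Its diameter is the maximum over pairs of vertices of the graph distance. The notation $L_{CC}(10,k)$ is just a name for the displayed polynomial value. *)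

theory Defs
  imports "HOL-Number_Theory.Cong" "Graph_Theory.Pair_Digraph" "Graph_Theory.Shortest_Path"
begin

text \<open>
  The group of integers modulo \<open>n\<close> is represented by the residues \<open>{0..<n}\<close>; an undirected
  graph is a symmetric digraph, as in \<open>Graph_Theory\<close>.
\<close>

definition circulant_graph :: "int \<Rightarrow> int set \<Rightarrow> int pair_pre_digraph" where
  "circulant_graph n S = \<lparr>pverts = {0..<n},
     parcs = {(i, j). i \<in> {0..<n} \<and> j \<in> {0..<n} \<and>
                (\<exists>g\<in>S. [j - i = g] (mod n) \<or> [j - i = - g] (mod n))}\<rparr>"

text \<open>
  Distances are infima of walk lengths, valued in the extended reals: they are infinite between
  different components, so a finite diameter entails connectedness. For finite nonempty graphs
  the suprema are maxima.
\<close>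

definition graph_diameter :: "('a, 'b) pre_digraph \<Rightarrow> ereal" where
  "graph_diameter G = (SUP u\<in>verts G. SUP v\<in>verts G. wf_digraph.\<mu> G (\<lambda>_. 1) u v)"

text \<open>
  The divisions below are exact for \<open>k\<close> divisible by 5; see the lemmas that follow.
\<close>

definition L_CC10 :: "nat \<Rightarrow> int" where
  "L_CC10 k = (512 * int k ^ 5 + 1280 * int k ^ 4 + 6400 * int k ^ 3 + 8000 * int k ^ 2
     + 6250 * int k + 3125) div 3125"

definition gens10 :: "nat \<Rightarrow> int set" where
  "gens10 k =
    {1,
     (32 * int k ^ 3 + 40 * int k ^ 2 + 300 * int k + 125) div 125,
     (128 * int k ^ 4 + 160 * int k ^ 3 + 1200 * int k ^ 2 - 625) div 625,
     (128 * int k ^ 4 + 320 * int k ^ 3 + 1600 * int k ^ 2 + 1750 * int k + 1250) div 625,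
     (256 * int k ^ 4 + 640 * int k ^ 3 + 3000 * int k ^ 2 + 3750 * int k + 1250) div 625}"

lemma L_CC10_exact:
  assumes "[k = 0] (mod 5)"
  shows "3125 dvd 512 * int k ^ 5 + 1280 * int k ^ 4 + 6400 * int k ^ 3 + 8000 * int k ^ 2
     + 6250 * int k + 3125"
proof -
  from assms obtain m where "k = 5 * m" by (auto simp: cong_0_iff)
  then have "512 * int k ^ 5 + 1280 * int k ^ 4 + 6400 * int k ^ 3 + 8000 * int k ^ 2
     + 6250 * int k + 3125 = 3125 * (512 * int m ^ 5 + 256 * int m ^ 4 + 256 * int m ^ 3
     + 64 * int m ^ 2 + 10 * int m + 1)"
    by (simp add: power_mult_distrib)
  then show ?thesis by (metis dvd_triv_left)
qed

lemma gens10_exact: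
  assumes "[k = 0] (mod 5)"
  shows "125 dvd 32 * int k ^ 3 + 40 * int k ^ 2 + 300 * int k + 125"
    and "625 dvd 128 * int k ^ 4 + 160 * int k ^ 3 + 1200 * int k ^ 2 - 625"
    and "625 dvd 128 * int k ^ 4 + 320 * int k ^ 3 + 1600 * int k ^ 2 + 1750 * int k + 1250"
    and "625 dvd 256 * int k ^ 4 + 640 * int k ^ 3 + 3000 * int k ^ 2 + 3750 * int k + 1250"
proof -
  from assms obtain m where m: "k = 5 * m" by (auto simp: cong_0_iff)
  have "32 * int k ^ 3 + 40 * int k ^ 2 + 300 * int k + 125
      = 125 * (32 * int m ^ 3 + 8 * int m ^ 2 + 12 * int m + 1)"
    using m by (simp add: power_mult_distrib)
  then show "125 dvd 32 * int k ^ 3 + 40 * int k ^ 2 + 300 * int k + 125"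
    by (metis dvd_triv_left)
  have "128 * int k ^ 4 + 160 * int k ^ 3 + 1200 * int k ^ 2 - 625
      = 625 * (128 * int m ^ 4 + 32 * int m ^ 3 + 48 * int m ^ 2 - 1)"
    using m by (simp add: power_mult_distrib)
  then show "625 dvd 128 * int k ^ 4 + 160 * int k ^ 3 + 1200 * int k ^ 2 - 625"
    by (metis dvd_triv_left)
  have "128 * int k ^ 4 + 320 * int k ^ 3 + 1600 * int k ^ 2 + 1750 * int k + 1250
      = 625 * (128 * int m ^ 4 + 64 * int m ^ 3 + 64 * int m ^ 2 + 14 * int m + 2)"
    using m by (simp add: power_mult_distrib)
  then show "625 dvd 128 * int k ^ 4 + 320 * int k ^ 3 + 1600 * int k ^ 2 + 1750 * int k + 1250"
    by (metis dvd_triv_left)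
  have "256 * int k ^ 4 + 640 * int k ^ 3 + 3000 * int k ^ 2 + 3750 * int k + 1250
      = 625 * (256 * int m ^ 4 + 128 * int m ^ 3 + 120 * int m ^ 2 + 30 * int m + 2)"
    using m by (simp add: power_mult_distrib)
  then show "625 dvd 256 * int k ^ 4 + 640 * int k ^ 3 + 3000 * int k ^ 2 + 3750 * int k + 1250"
    by (metis dvd_triv_left)
qed

lemma circulant_graph_pseudo_graph: "pair_pseudo_graph (circulant_graph n S)"
proof
  show "finite (parcs (circulant_graph n S))"
    by (rule finite_subset[of _ "{0..<n} \<times> {0..<n}"]) (auto simp: circulant_graph_def)
  have *: "[i - j = - g] (mod n) \<longleftrightarrow> [j - i = g] (mod n)" for i j g :: int
    by (metis cong_minus_minus_iff minus_diff_eq)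
  have "[i - j = g] (mod n) \<longleftrightarrow> [j - i = - g] (mod n)" for i j g :: int
    using *[of j i g] by simp
  with * have "(i, j) \<in> parcs (circulant_graph n S) \<Longrightarrow> (j, i) \<in> parcs (circulant_graph n S)"
    for i j
    unfolding circulant_graph_def by (simp, blast)
  then show "symmetric (with_proj (circulant_graph n S))"
    unfolding symmetric_def by (auto intro!: symI)
qed (auto simp: circulant_graph_def)

end

theory Submission
  imports Defs
begin

text \<open>
  Write \<open>k = 5 m\<close>. The distance between two vertices of the circulant graph is the least \<open>\<ell>\<^sub>1\<close>-norm
  in a coset of the lattice \<open>L\<close> of all \<open>v \<in> \<int>\<^sup>5\<close> with \<open>v \<bullet> g = 0\<close> modulo \<open>n\<close>. This lattice is a
  perturbed body-centred cubic lattice: it consists of the combinations \<open>\<Sum>i. c i f\<^sub>i\<close> with all \<open>c i\<close>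
  integers or all \<open>c i\<close> half-integers, where \<open>f\<^sub>i = W\<^sub>i e\<^sub>i + A\<^sub>i\<close> for a diagonal matrix \<open>W\<close> with
  entries \<open>4 m\<close> or \<open>4 m + 1\<close> and a skew-symmetric matrix \<open>A\<close> with entries in \<open>{-1, 0, 1}\<close>.

  By skew-symmetry, \<open>h\<^sub>s = (\<Sum>i. s i f\<^sub>i) / 2\<close> has norm \<open>10 m + 1\<close> for each sign vector \<open>s\<close>. Let \<open>y\<close> be
  shortest in its coset. If \<open>y\<close> has no zero entry and sign vector \<open>s\<close>, then comparing \<open>y\<close> with
  \<open>y - s j f\<^sub>j\<close> for all \<open>j\<close> says exactly that \<open>y\<close> lies in the box spanned by \<open>0\<close> and \<open>h\<^sub>s\<close>, so
  \<open>\<parallel>y\<parallel> + \<parallel>y - h\<^sub>s\<parallel> = 10 m + 1\<close> and hence \<open>\<parallel>y\<parallel> \<le> 5 m\<close>. If \<open>y\<close> has zeros, their signs can be chosen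
  such that the same holds; this uses the moves \<open>y - \<Sum>j\<in>T. s j f\<^sub>j\<close> and is a finite check that no
  longer depends on \<open>m\<close>.

  For the lower bound, every lattice point has distance at least \<open>5 m\<close> from \<open>(m, m, m, m, m)\<close>.
\<close>

section \<open>The lattice\<close>

definition skew :: "nat \<Rightarrow> nat \<Rightarrow> int" where
  "skew i j = [[0, 1, 1, 1, -1], [-1, 0, 0, 1, -1], [-1, 0, 0, 1, 0], [-1, -1, -1, 0, 0],
     [1, 1, 0, 0, 0]] ! i ! j"

definition modulus :: "int \<Rightarrow> int" where
  "modulus m = 512 * m ^ 5 + 256 * m ^ 4 + 256 * m ^ 3 + 64 * m ^ 2 + 10 * m + 1"

definition gen :: "int \<Rightarrow> nat \<Rightarrow> int" where
  "gen m j = [1,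
     32 * m ^ 3 + 8 * m ^ 2 + 12 * m + 1,
     128 * m ^ 4 + 32 * m ^ 3 + 48 * m ^ 2 - 1,
     128 * m ^ 4 + 64 * m ^ 3 + 64 * m ^ 2 + 14 * m + 2,
     256 * m ^ 4 + 128 * m ^ 3 + 120 * m ^ 2 + 30 * m + 2] ! j"

definition width :: "int \<Rightarrow> nat \<Rightarrow> int" where
  "width m j = 4 * m + [0, 1, 0, 1, 0] ! j"

text \<open>
  The rows \<open>f\<^sub>i\<close>, found by lattice reduction, span a sublattice of index 2 in \<open>L\<close>.
\<close>

definition row :: "int \<Rightarrow> nat \<Rightarrow> nat \<Rightarrow> int" where
  "row m i j = skew i j + (if i = j then width m j else 0)"

text \<open>A vector records signed numbers of steps along the five generators; \<open>wt\<close> is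
  the resulting displacement. Only the entries at indices below 5 matter.\<close>

definition wt :: "int \<Rightarrow> (nat \<Rightarrow> int) \<Rightarrow> int" where
  "wt m y = (\<Sum>j<5. y j * gen m j)"

definition norm1 :: "(nat \<Rightarrow> int) \<Rightarrow> int" where
  "norm1 y = (\<Sum>j<5. \<bar>y j\<bar>)"

definition shortest :: "int \<Rightarrow> (nat \<Rightarrow> int) \<Rightarrow> bool" where
  "shortest m y \<longleftrightarrow> (\<forall>v. modulus m dvd wt m v \<longrightarrow> norm1 y \<le> norm1 (\<lambda>j. y j - v j))"

lemma less_5_cases: "(j::nat) < 5 \<longleftrightarrow> j = 0 \<or> j = 1 \<or> j = 2 \<or> j = 3 \<or> j = 4"
  by auto

lemma sum_less_5: "(\<Sum>j<5. f j) = f 0 + f 1 + f 2 + f 3 + f 4" for f :: "nat \<Rightarrow> int"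
  by (simp add: eval_nat_numeral lessThan_Suc ac_simps)

lemma skew_antisym: "i < 5 \<Longrightarrow> j < 5 \<Longrightarrow> skew j i = - skew i j"
  by (auto simp: less_5_cases skew_def)

lemma skew_diag: "i < 5 \<Longrightarrow> skew i i = 0"
  by (auto simp: less_5_cases skew_def)

lemma abs_skew_le: "i < 5 \<Longrightarrow> j < 5 \<Longrightarrow> \<bar>skew i j\<bar> \<le> 1"
  by (auto simp: less_5_cases skew_def)

lemma width_ge: "j < 5 \<Longrightarrow> width m j \<ge> 4 * m"
  by (auto simp: less_5_cases width_def)

lemma odd_modulus: "odd (modulus m)"
  by (simp add: modulus_def)

lemma wt_row: 
  assumes "i < 5"
  shows "wt m (row m i) = modulus m * [0, 0, 1, 1, 2] ! i"
  using assms unfolding less_5_cases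
  by (elim disjE) (simp_all add: wt_def sum_less_5 row_def skew_def width_def gen_def modulus_def algebra_simps eval_nat_numeral)

lemma wt_sum: "wt m (\<lambda>j. \<Sum>i\<in>I. c i * f i j) = (\<Sum>i\<in>I. c i * wt m (f i))"
  unfolding wt_def sum_distrib_left sum_distrib_right
  by (subst sum.swap) (simp add: mult.assoc)

lemma modulus_dvd_wt_comb:
  assumes "I \<subseteq> {..<5}"
  shows "modulus m dvd wt m (\<lambda>j. \<Sum>i\<in>I. c i * row m i j)"
  unfolding wt_sum using assms by (intro dvd_sum) (auto simp: wt_row)

text \<open>The modulus is odd, so halving an integer combination of the rows does not leave
  \<open>L\<close> as long as the result is integral.\<close>

lemma modulus_dvd_wt_half:
  assumes "\<And>j. j < 5 \<Longrightarrow> 2 * v j = (\<Sum>i<5. c i * row m i j)"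
  shows "modulus m dvd wt m v"
proof -
  have "2 * wt m v = wt m (\<lambda>j. \<Sum>i<5. c i * row m i j)"
    unfolding wt_def sum_distrib_left using assms
    by (intro sum.cong) (auto simp: mult.assoc[symmetric])
  then have "modulus m dvd 2 * wt m v"
    using modulus_dvd_wt_comb[of "{..<5}" m c] by simp
  moreover have "coprime (modulus m) 2"
    using odd_modulus by simp
  ultimately show ?thesis
    by (simp add: coprime_dvd_mult_right_iff)
qed

section \<open>Shortest vectors of the cosets\<close>

lemma shortestD:
  assumes "shortest m y" "modulus m dvd wt m v" "\<And>j. j < 5 \<Longrightarrow> v j = w j"
  shows "(\<Sum>j<5. \<bar>y j\<bar>) \<le> (\<Sum>j<5. \<bar>y j - w j\<bar>)"
proof -
  have "(\<Sum>j<5. \<bar>y j - v j\<bar>) = (\<Sum>j<5. \<bar>y j - w j\<bar>)"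
    using assms(3) by (intro sum.cong) auto
  then show ?thesis
    using assms(1,2) by (metis shortest_def norm1_def)
qed

lemma shortest_uminus: "shortest m y \<Longrightarrow> shortest m (\<lambda>j. - y j)"
  unfolding shortest_def
proof (intro allI impI)
  fix v assume *: "\<forall>v. modulus m dvd wt m v \<longrightarrow> norm1 y \<le> norm1 (\<lambda>j. y j - v j)"
    and "modulus m dvd wt m v"
  then have "modulus m dvd wt m (\<lambda>j. - v j)"
    by (simp add: wt_def sum_negf)
  with * have "norm1 y \<le> norm1 (\<lambda>j. y j - - v j)"
    by blast
  also have "\<dots> = norm1 (\<lambda>j. - y j - v j)"
    unfolding norm1_def by (intro sum.cong) auto
  finally show "norm1 (\<lambda>j. - y j) \<le> norm1 (\<lambda>j. - y j - v j)"
    by (simp add: norm1_def)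
qed

lemma ex_shortest:
  obtains y where "[wt m y = r] (mod modulus m)" "shortest m y"
proof -
  define P where "P y \<longleftrightarrow> [wt m y = r] (mod modulus m)" for y
  \<comment> \<open>Every class is inhabited, since \<open>gen m 0 = 1\<close>.\<close>
  have "P (\<lambda>j. if j = 0 then r else 0)"
    by (simp add: P_def wt_def sum_less_5 gen_def)
  then obtain y where y: "P y" "\<And>z. P z \<Longrightarrow> nat (norm1 y) \<le> nat (norm1 z)"
    using ex_has_least_nat[of P _ "\<lambda>y. nat (norm1 y)"] by blast
  have "shortest m y"
    unfolding shortest_def
  proof (intro allI impI)
    fix v assume "modulus m dvd wt m v"
    then have "[wt m y - wt m v = r - 0] (mod modulus m)"
      using y(1) unfolding P_def by (intro cong_diff) (auto simp: cong_0_iff)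
    moreover have "wt m y - wt m v = wt m (\<lambda>j. y j - v j)"
      by (simp add: wt_def sum_subtractf left_diff_distrib)
    ultimately have "P (\<lambda>j. y j - v j)"
      by (simp add: P_def)
    from y(2)[OF this] show "norm1 y \<le> norm1 (\<lambda>j. y j - v j)"
      by (simp add: norm1_def sum_nonneg nat_le_eq_zle)
  qed
  with y(1) show thesis
    by (auto simp: P_def intro: that)
qed

text \<open>
  The only case where an entry of a shortest vector can exceed the corresponding \<open>W\<^sub>j\<close>.
\<close>

lemma shortest_one_bound:
  assumes "shortest 1 y" "y 0 > 4"
  shows "norm1 y \<le> 5"
proof -
  have mod1: "modulus 1 = 1099" and gen1: "gen 1 j = [1, 53, 207, 272, 536] ! j" for j
    by (simp_all add: modulus_def gen_def)
  have le: "\<bar>y 0\<bar> + \<bar>y 1\<bar> + \<bar>y 2\<bar> + \<bar>y 3\<bar> + \<bar>y 4\<bar> \<le>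
      \<bar>y 0 - a\<bar> + \<bar>y 1 - b\<bar> + \<bar>y 2 - c\<bar> + \<bar>y 3 - d\<bar> + \<bar>y 4 - e\<bar>"
    if "1099 dvd a + b * 53 + c * 207 + d * 272 + e * 536" for a b c d e
  proof -
    have "modulus 1 dvd wt 1 ((!) [a, b, c, d, e])"
      using that by (simp add: wt_def sum_less_5 gen1 mod1)
    from shortestD[OF assms(1) this, of "(!) [a, b, c, d, e]"] show ?thesis
      by (simp add: sum_less_5)
  qed
  \<comment> \<open>\<open>(4, 1, 1, 1, -1)\<close> is \<open>row 1 0\<close>. Subtracting it gains
    exactly 4 at entry 0, so each of the four unit shifts has to lengthen its entry. Three more
    short lattice vectors then leave only \<open>(5, 0, 0, 0, 0)\<close>.\<close>
  have signs: "y 1 \<le> 0" "y 2 \<le> 0" "y 3 \<le> 0" "y 4 \<ge> 0"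
    using le[of 4 1 1 1 "-1"] assms(2) by simp_all
  then have *: "y 0 = 5" "y 3 = 0" "y 4 = 0"
    using le[of 8 0 0 "-2" 1] assms(2) by simp_all
  then have "y 1 = 0" "y 2 = 0"
    using le[of 5 "-4" 1 0 0] le[of 5 1 "-3" 0 "-1"] signs by simp_all
  with * show ?thesis
    by (simp add: norm1_def sum_less_5)
qed

text \<open>Subtracting \<open>sgn (y j) * row m j\<close> gains \<open>width m j\<close> at a too
  large entry and costs at most the number of nonzero entries in row \<open>j\<close> of
  \<open>skew\<close>. The cost reaches the gain only for \<open>j = 0\<close> and
  \<open>m = 1\<close>.\<close>

lemma shortest_width:
  assumes "m \<ge> 1" "shortest m y"
  shows "norm1 y \<le> 5 * m \<or> (\<forall>j<5. \<bar>y j\<bar> \<le> width m j)"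
proof (rule ccontr)
  assume "\<not> ?thesis"
  then obtain j where j: "j < 5" "width m j < \<bar>y j\<bar>" and big: "5 * m < norm1 y"
    by auto
  have w: "width m j \<ge> 4"
    using width_ge[OF j(1), of m] assms(1) by linarith
  have "modulus m dvd wt m (\<lambda>l. \<Sum>i\<in>{j}. sgn (y j) * row m i l)"
    using j(1) by (intro modulus_dvd_wt_comb) auto
  then have "(\<Sum>l<5. \<bar>y l\<bar>) \<le> (\<Sum>l<5. \<bar>y l - sgn (y j) * row m j l\<bar>)"
    by (intro shortestD[OF assms(2)]) auto
  also have "\<dots> \<le> (\<Sum>l<5. \<bar>y l\<bar> + \<bar>skew j l\<bar> - (if l = j then width m j else 0))"
  proof (rule sum_mono)
    fix l :: nat assume "l \<in> {..<5}"
    show "\<bar>y l - sgn (y j) * row m j l\<bar> \<le> \<bar>y l\<bar> + \<bar>skew j l\<bar> - (if l = j then width m j else 0)"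
      using j w skew_diag[OF j(1)] by (auto simp: row_def sgn_if)
  qed
  also have "\<dots> = (\<Sum>l<5. \<bar>y l\<bar>) + (\<Sum>l<5. \<bar>skew j l\<bar>) - width m j"
    using j(1) by (simp add: sum.distrib sum_subtractf)
  finally have "width m j \<le> (\<Sum>l<5. \<bar>skew j l\<bar>)"
    by simp
  then have "j = 0 \<and> m = 1"
    using j(1) assms(1) by (auto simp: less_5_cases width_def skew_def sum_less_5)
  then have "m = 1" "j = 0" by auto
  then have "y 0 > 4 \<or> - y 0 > 4"
    using j by (auto simp: width_def)
  then have "norm1 y \<le> 5"
    using shortest_one_bound[of y] shortest_one_bound[of "\<lambda>j. - y j"] shortest_uminus[OF assms(2)] assms(2)
    by (auto simp: norm1_def \<open>m = 1\<close>)
  then show False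
    using big \<open>m = 1\<close> by simp
qed

section \<open>Signs for the zero entries\<close>

text \<open>
  Let \<open>\<sigma>\<close> be the sign vector of \<open>y\<close>. A move subtracts \<open>\<sigma> j f\<^sub>j\<close> for all \<open>j \<in> T\<close> and thereby shifts
  entry \<open>l \<notin> T\<close> by \<open>- push \<sigma> T l\<close>. An admissible move does not carry a nonzero entry outside \<open>T\<close>
  across zero.
\<close>

definition push :: "(nat \<Rightarrow> int) \<Rightarrow> nat list \<Rightarrow> nat \<Rightarrow> int" where
  "push \<sigma> T l = (\<Sum>j\<leftarrow>T. \<sigma> j * skew j l)"

definition zero_sum :: "(nat \<Rightarrow> int) \<Rightarrow> (nat \<Rightarrow> int) \<Rightarrow> int" where
  "zero_sum \<sigma> f = (\<Sum>i\<leftarrow>[0..<5]. if \<sigma> i = 0 then f i else 0)"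

definition admissible :: "(nat \<Rightarrow> int) \<Rightarrow> nat list \<Rightarrow> bool" where
  "admissible \<sigma> T \<longleftrightarrow> (\<forall>l\<in>set [0..<5]. l \<in> set T \<or> \<sigma> l * push \<sigma> T l \<le> 1)"

text \<open>When \<open>\<tau>\<close> is the excess, this says that completing
  \<open>\<sigma>\<close> by the signs \<open>s\<close> puts the nonzero entries into the
  box.\<close>

definition compatible :: "(nat \<Rightarrow> int) \<Rightarrow> (nat \<Rightarrow> int) \<Rightarrow> (nat \<Rightarrow> int) \<Rightarrow> bool" where
  "compatible \<sigma> \<tau> s \<longleftrightarrow>
     (\<forall>j\<in>set [0..<5]. \<sigma> j = 0 \<or> \<tau> j \<le> zero_sum \<sigma> (\<lambda>i. s i * \<sigma> j * skew i j))"

abbreviation zero_degree :: "(nat \<Rightarrow> int) \<Rightarrow> nat \<Rightarrow> int" where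
  "zero_degree \<sigma> j \<equiv> zero_sum \<sigma> (\<lambda>i. \<bar>skew i j\<bar>)"

text \<open>
  The values of the excesses that need to be considered: smaller ones impose no condition on the
  signs, and larger ones are excluded by the moves with \<open>T = {j}\<close>. Values that stand for all
  smaller ones must not be used in a move, whence the filter in \<open>solvable\<close>.
\<close>

definition excesses :: "(nat \<Rightarrow> int) \<Rightarrow> int list list" where
  "excesses \<sigma> = product_lists (map (\<lambda>j. if \<sigma> j = 0 then [0]
     else map (\<lambda>i. 2 * int i - zero_degree \<sigma> j) [0..<Suc (nat (zero_degree \<sigma> j))]) [0..<5])"

definition extensions :: "(nat \<Rightarrow> int) \<Rightarrow> int list list" where
  "extensions \<sigma> = product_lists (map (\<lambda>i. if \<sigma> i = 0 then [1, -1] else [\<sigma> i]) [0..<5])"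

text \<open>The alternative to a good choice of signs is a move that would shorten \<open>y\<close>.
  The conditional defers the search for moves until that for signs has failed.\<close>

definition solvable :: "(nat \<Rightarrow> int) \<Rightarrow> (nat \<Rightarrow> int) \<Rightarrow> bool" where
  "solvable \<sigma> \<tau> \<longleftrightarrow>
     (if \<exists>s\<in>set (extensions \<sigma>). compatible \<sigma> \<tau> ((!) s) then True
      else \<exists>T\<in>set (subseqs (filter (\<lambda>j. \<sigma> j \<noteq> 0 \<and> \<tau> j > - zero_degree \<sigma> j) [0..<5])).
        admissible \<sigma> T \<and> zero_sum \<sigma> (\<lambda>l. \<bar>push \<sigma> T l\<bar>) < (\<Sum>j\<leftarrow>T. \<tau> j))"

lemma all_solvable:
  "\<forall>x\<in>set (product_lists (replicate 5 [-1, 0, 1])). \<forall>t\<in>set (excesses ((!) x)).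
     solvable ((!) x) ((!) t)"
  by code_simp

lemma in_set_product_lists:
  "xs \<in> set (product_lists xss) \<longleftrightarrow> list_all2 (\<lambda>x ys. x \<in> set ys) xs xss"
  by (simp add: product_lists_set)

lemma zero_sum_cong:
  assumes "\<And>i. i < 5 \<Longrightarrow> \<sigma> i = \<sigma>' i" "\<And>i. i < 5 \<Longrightarrow> f i = g i"
  shows "zero_sum \<sigma> f = zero_sum \<sigma>' g"
  unfolding zero_sum_def using assms by (intro arg_cong[of _ _ sum_list] map_cong) auto

text \<open>Reduces arbitrary excesses to the finite table: \<open>single\<close> bounds them above,
  \<open>parity\<close> puts them on its grid, and \<open>moves\<close> rules out the second
  alternative of \<open>solvable\<close>.\<close>

lemma sign_choice:
  fixes \<sigma> \<tau> :: "nat \<Rightarrow> int"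
  assumes \<sigma>: "\<And>i. i < 5 \<Longrightarrow> \<sigma> i \<in> {-1, 0, 1}"
    and parity: "\<And>j. j < 5 \<Longrightarrow> \<sigma> j \<noteq> 0 \<Longrightarrow> even (\<tau> j - zero_degree \<sigma> j)"
    and single: "\<And>j. j < 5 \<Longrightarrow> \<sigma> j \<noteq> 0 \<Longrightarrow> \<tau> j \<le> zero_degree \<sigma> j"
    and moves: "\<And>T. distinct T \<Longrightarrow> set T \<subseteq> {j. j < 5 \<and> \<sigma> j \<noteq> 0} \<Longrightarrow> admissible \<sigma> T \<Longrightarrow>
      (\<Sum>j\<leftarrow>T. \<tau> j) \<le> zero_sum \<sigma> (\<lambda>l. \<bar>push \<sigma> T l\<bar>)"
  shows "\<exists>s. (\<forall>i<5. s i \<in> {-1, 1}) \<and> (\<forall>i<5. \<sigma> i \<noteq> 0 \<longrightarrow> s i = \<sigma> i) \<and>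
    (\<forall>j<5. \<sigma> j \<noteq> 0 \<longrightarrow> \<tau> j \<le> zero_sum \<sigma> (\<lambda>i. s i * \<sigma> j * skew i j))"
proof -
  define x where "x = map \<sigma> [0..<5]"
  let ?x = "(!) x"
  have x: "?x i = \<sigma> i" if "i < 5" for i
    using that by (simp add: x_def)
  have zs: "zero_sum ?x f = zero_sum \<sigma> f" for f
    by (rule zero_sum_cong) (simp_all add: x)
  have "x \<in> set (product_lists (replicate 5 [-1, 0, 1]))"
    using \<sigma> by (auto simp: in_set_product_lists x_def list_all2_conv_all_nth)
  \<comment> \<open>Clamping from below is harmless, because the right-hand side in
    \<open>compatible\<close> is never less than \<open>- zero_degree \<sigma> j\<close>.\<close>
  define \<tau>' where "\<tau>' j = (if \<sigma> j = 0 then 0 else max (\<tau> j) (- zero_degree \<sigma> j))" for j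
  define t where "t = map \<tau>' [0..<5]"
  let ?t = "(!) t"
  have t: "?t i = \<tau>' i" if "i < 5" for i
    using that by (simp add: t_def)
  have zd: "zero_degree \<sigma> j \<ge> 0" for j
    unfolding zero_sum_def by (rule sum_list_nonneg) auto
  have "\<tau>' j \<in> set (map (\<lambda>i. 2 * int i - zero_degree \<sigma> j) [0..<Suc (nat (zero_degree \<sigma> j))])"
    if "j < 5" "\<sigma> j \<noteq> 0" for j
    unfolding set_map set_upt
  proof (rule image_eqI)
    have ev: "even (\<tau>' j + zero_degree \<sigma> j)"
      using parity[OF that] that(2) by (auto simp: \<tau>'_def max_def)
    have rg: "0 \<le> \<tau>' j + zero_degree \<sigma> j" "\<tau>' j \<le> zero_degree \<sigma> j"
      using single[OF that] that(2) zd[of j] by (auto simp: \<tau>'_def max_def)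
    show "\<tau>' j = 2 * int (nat ((\<tau>' j + zero_degree \<sigma> j) div 2)) - zero_degree \<sigma> j"
      using ev rg by simp
    show "nat ((\<tau>' j + zero_degree \<sigma> j) div 2) \<in> {0..<Suc (nat (zero_degree \<sigma> j))}"
      using rg by auto
  qed
  moreover have "\<tau>' j = 0" if "\<sigma> j = 0" for j
    using that by (simp add: \<tau>'_def)
  ultimately have "t \<in> set (excesses ?x)"
    by (simp add: excesses_def in_set_product_lists list_all2_conv_all_nth zs x t_def
        del: upt_Suc set_map set_upt)
  with \<open>x \<in> _\<close> all_solvable have solv: "solvable ?x ?t"
    by blast
  have "\<exists>s\<in>set (extensions ?x). compatible ?x ?t ((!) s)"
  proof (rule ccontr)
    assume "\<not> ?thesis"
    then obtain T where T: "T \<in> set (subseqs (filter (\<lambda>j. ?x j \<noteq> 0 \<and> ?t j > - zero_degree ?x j) [0..<5]))"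
        "admissible ?x T" "zero_sum ?x (\<lambda>l. \<bar>push ?x T l\<bar>) < (\<Sum>j\<leftarrow>T. ?t j)"
      using solv by (auto simp: solvable_def split: if_splits)
    have "distinct T"
      using T(1) by (rule subseqs_distinctD) simp
    have "set T \<in> Pow (set (filter (\<lambda>j. ?x j \<noteq> 0 \<and> ?t j > - zero_degree ?x j) [0..<5]))"
      unfolding subseqs_powset[symmetric] using T(1) by (rule imageI)
    then have T': "set T \<subseteq> {j. j < 5 \<and> ?x j \<noteq> 0 \<and> ?t j > - zero_degree ?x j}"
      by auto
    have push: "push ?x T l = push \<sigma> T l" for l
      unfolding push_def using T' x by (intro arg_cong[of _ _ sum_list] map_cong) auto
    \<comment> \<open>The filter in \<open>solvable\<close> keeps only indices whose value was not
      raised by the clamping.\<close>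
    have "?t j = \<tau> j" if "j \<in> set T" for j
    proof -
      have "j < 5" "\<sigma> j \<noteq> 0" "\<tau>' j > - zero_degree \<sigma> j"
        using T' that x t zs by auto
      then show ?thesis
        by (simp add: t \<tau>'_def)
    qed
    then have "(\<Sum>j\<leftarrow>T. ?t j) = (\<Sum>j\<leftarrow>T. \<tau> j)"
      by (intro arg_cong[of _ _ sum_list] map_cong) auto
    moreover have "set T \<subseteq> {j. j < 5 \<and> \<sigma> j \<noteq> 0}"
      using T' x by auto
    moreover have "admissible \<sigma> T"
      using T(2) x push by (simp add: admissible_def)
    ultimately show False
      using moves[OF \<open>distinct T\<close>] T(3) push zs by simp
  qed
  then obtain s where s: "s \<in> set (extensions ?x)" "compatible ?x ?t ((!) s)"
    by blast
  have s': "s ! i \<in> set (if \<sigma> i = 0 then [1, -1] else [\<sigma> i])" if "i < 5" for i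
    using s(1) that by (auto simp: extensions_def in_set_product_lists list_all2_conv_all_nth x)
  show ?thesis
  proof (intro exI[of _ "(!) s"] conjI allI impI)
    show "s ! i \<in> {-1, 1}" if "i < 5" for i
      using s'[OF that] \<sigma>[OF that] by (auto split: if_splits)
    show "s ! i = \<sigma> i" if "i < 5" "\<sigma> i \<noteq> 0" for i
      using s'[OF that(1)] that(2) by simp
    show "\<tau> j \<le> zero_sum \<sigma> (\<lambda>i. s ! i * \<sigma> j * skew i j)" if "j < 5" "\<sigma> j \<noteq> 0" for j
    proof -
      have "\<tau>' j \<le> zero_sum \<sigma> (\<lambda>i. s ! i * \<sigma> j * skew i j)"
        using s(2) that by (auto simp: compatible_def x t zs)
      then show ?thesis
        using that(2) by (simp add: \<tau>'_def)
    qed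
  qed
qed

section \<open>Upper bound\<close>

lemma zero_sum_eq: "zero_sum \<sigma> f = (\<Sum>i<5. if \<sigma> i = 0 then f i else 0)"
  by (simp add: zero_sum_def interv_sum_list_conv_sum_set_nat atLeast0LessThan)

text \<open>
  A zero-free \<open>y\<close> lies in the box spanned by \<open>0\<close> and \<open>h\<^sub>s\<close> iff no entry has positive excess.
\<close>

definition excess :: "int \<Rightarrow> (nat \<Rightarrow> int) \<Rightarrow> nat \<Rightarrow> int" where
  "excess m y j = 2 * \<bar>y j\<bar> - width m j - (\<Sum>i<5. sgn (y i) * sgn (y j) * skew i j)"

lemma push_eq:
  assumes "distinct T"
  shows "push \<sigma> T l = (\<Sum>j\<in>set T. \<sigma> j * skew j l)"
  using assms by (simp add: push_def sum_list_distinct_conv_sum_set)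

text \<open>The quadratic form of a skew-symmetric matrix vanishes.\<close>

lemma sum_push_self:
  assumes "distinct T" "set T \<subseteq> {..<5}"
  shows "(\<Sum>l\<in>set T. \<sigma> l * push \<sigma> T l) = 0"
proof -
  let ?S = "\<Sum>l\<in>set T. \<Sum>j\<in>set T. \<sigma> l * (\<sigma> j * skew j l)"
  have "?S = (\<Sum>l\<in>set T. \<Sum>j\<in>set T. \<sigma> j * (\<sigma> l * skew l j))"
    by (rule sum.swap)
  also have "\<dots> = - ?S"
    unfolding sum_negf[symmetric]
  proof (intro sum.cong refl)
    fix l j assume "l \<in> set T" "j \<in> set T"
    then have "skew l j = - skew j l"
      using assms(2) by (intro skew_antisym) auto
    then show "\<sigma> j * (\<sigma> l * skew l j) = - (\<sigma> l * (\<sigma> j * skew j l))"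
      by simp
  qed
  finally show ?thesis
    using assms(1) by (simp add: push_eq sum_distrib_left)
qed

lemma move_bound:
  fixes y :: "nat \<Rightarrow> int"
  defines "\<sigma> \<equiv> \<lambda>i. sgn (y i)"
  assumes y: "shortest m y"
    and T: "distinct T" "set T \<subseteq> {j. j < 5 \<and> \<sigma> j \<noteq> 0}" "admissible \<sigma> T"
    and room: "\<And>l. l \<in> set T \<Longrightarrow> 0 \<le> width m l - \<bar>y l\<bar> + \<sigma> l * push \<sigma> T l"
  shows "(\<Sum>j\<leftarrow>T. excess m y j) \<le> zero_sum \<sigma> (\<lambda>l. \<bar>push \<sigma> T l\<bar>)"
proof -
  let ?P = "push \<sigma> T"
  \<comment> \<open>\<open>c\<close> and \<open>z\<close> correct the uniform change
    \<open>- \<sigma> l * ?P l\<close>: by \<open>room\<close>, entries in \<open>T\<close> reach or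
    cross zero, and zero entries outside \<open>T\<close> grow by
    \<open>\<bar>?P l\<bar>\<close>.\<close>
  define c where "c l = (if l \<in> set T then width m l - 2 * \<bar>y l\<bar> + 2 * (\<sigma> l * ?P l) else 0)" for l
  define z where "z l = (if \<sigma> l = 0 then \<bar>?P l\<bar> else 0)" for l
  have T5: "set T \<subseteq> {..<5}"
    using T(2) by auto
  have v: "(\<Sum>i\<in>set T. \<sigma> i * row m i l) = ?P l + (if l \<in> set T then \<sigma> l * width m l else 0)" for l
    by (simp add: row_def push_eq[OF T(1)] distrib_left sum.distrib if_distrib[of "\<lambda>x. _ * x"] cong: if_cong)
  have "modulus m dvd wt m (\<lambda>l. \<Sum>i\<in>set T. \<sigma> i * row m i l)"
    by (rule modulus_dvd_wt_comb) (rule T5)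
  then have "(\<Sum>l<5. \<bar>y l\<bar>) \<le> (\<Sum>l<5. \<bar>y l - (?P l + (if l \<in> set T then \<sigma> l * width m l else 0))\<bar>)"
    by (rule shortestD[OF y]) (rule v)
  also have "\<dots> \<le> (\<Sum>l<5. \<bar>y l\<bar> + c l + z l - \<sigma> l * ?P l)"
  proof (rule sum_mono)
    fix l :: nat assume l: "l \<in> {..<5}"
    consider "l \<in> set T" | "l \<notin> set T" "\<sigma> l = 0" | "l \<notin> set T" "\<sigma> l \<noteq> 0" by blast
    then show "\<bar>y l - (?P l + (if l \<in> set T then \<sigma> l * width m l else 0))\<bar>
        \<le> \<bar>y l\<bar> + c l + z l - \<sigma> l * ?P l"
    proof cases
      case 1
      then have "\<sigma> l \<noteq> 0"
        using T(2) by auto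
      then show ?thesis
        using 1 room[OF 1] by (auto simp: c_def z_def \<sigma>_def sgn_if)
    next
      case 2
      then show ?thesis
        by (auto simp: c_def z_def \<sigma>_def sgn_if split: if_splits)
    next
      case 3
      then have "\<sigma> l * ?P l \<le> 1"
        using T(3) l by (auto simp: admissible_def)
      then show ?thesis
        using 3 by (auto simp: c_def z_def \<sigma>_def sgn_if split: if_splits)
    qed
  qed
  also have "\<dots> = (\<Sum>l<5. \<bar>y l\<bar>) + (\<Sum>l<5. c l) + (\<Sum>l<5. z l) - (\<Sum>l<5. \<sigma> l * ?P l)"
    by (simp add: sum.distrib sum_subtractf)
  finally have "0 \<le> (\<Sum>l<5. c l) + (\<Sum>l<5. z l) - (\<Sum>l<5. \<sigma> l * ?P l)"
    by simp
  also have "(\<Sum>l<5. c l) = (\<Sum>l\<in>set T. width m l - 2 * \<bar>y l\<bar>)"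
  proof -
    have "(\<Sum>l<5. c l) = (\<Sum>l\<in>set T. width m l - 2 * \<bar>y l\<bar> + 2 * (\<sigma> l * ?P l))"
      unfolding c_def using T5 by (simp add: sum.If_cases Int_absorb1)
    then show ?thesis
      using sum_push_self[OF T(1) T5] by (simp add: sum.distrib flip: sum_distrib_left)
  qed
  also have "(\<Sum>l<5. \<sigma> l * ?P l) = - (\<Sum>j\<in>set T. \<Sum>i<5. \<sigma> i * \<sigma> j * skew i j)"
  proof -
    have "(\<Sum>l<5. \<sigma> l * ?P l) = (\<Sum>j\<in>set T. \<Sum>l<5. \<sigma> l * (\<sigma> j * skew j l))"
      unfolding push_eq[OF T(1)] sum_distrib_left by (rule sum.swap)
    also have "\<dots> = (\<Sum>j\<in>set T. \<Sum>i<5. - (\<sigma> i * \<sigma> j * skew i j))"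
    proof (intro sum.cong refl)
      fix j i assume "j \<in> set T" "i \<in> {..<5::nat}"
      then have "skew j i = - skew i j"
        using T5 by (intro skew_antisym) auto
      then show "\<sigma> i * (\<sigma> j * skew j i) = - (\<sigma> i * \<sigma> j * skew i j)"
        by simp
    qed
    finally show ?thesis
      by (simp add: sum_negf)
  qed
  finally have "(\<Sum>j\<in>set T. 2 * \<bar>y j\<bar> - width m j - (\<Sum>i<5. \<sigma> i * \<sigma> j * skew i j)) \<le> (\<Sum>l<5. z l)"
    by (simp add: sum_subtractf)
  then show ?thesis
    unfolding zero_sum_eq z_def excess_def \<sigma>_def
    by (simp add: sum_list_distinct_conv_sum_set[OF T(1)])
qed

lemma shortest_norm_le:
  assumes m: "m \<ge> 1" and y: "shortest m y"
  shows "norm1 y \<le> 5 * m"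
proof (cases "\<forall>j<5. \<bar>y j\<bar> \<le> width m j")
  case False
  then show ?thesis
    using shortest_width[OF m y] by blast
next
  case width: True
  define \<sigma> where "\<sigma> = (\<lambda>i. sgn (y i))"
  have \<sigma>: "\<sigma> i \<in> {-1, 0, 1}" for i
    by (auto simp: \<sigma>_def sgn_if)
  have w4: "width m j \<ge> 4" if "j < 5" for j
    using width_ge[OF that, of m] m by linarith
  have single: "excess m y j \<le> zero_degree \<sigma> j" if j: "j < 5" "\<sigma> j \<noteq> 0" for j
  proof -
    have p: "push \<sigma> [j] l = \<sigma> j * skew j l" for l
      by (simp add: push_def)
    have *: "\<bar>\<sigma> j * skew j l\<bar> = \<bar>skew l j\<bar>" if "l < 5" for l
      using \<sigma>[of j] j skew_antisym[OF j(1) that] by auto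
    have "\<sigma> l * (\<sigma> j * skew j l) \<le> 1" if "l < 5" for l
      using \<sigma>[of j] \<sigma>[of l] abs_skew_le[OF j(1) that] by auto
    then have "admissible \<sigma> [j]"
      by (simp add: admissible_def p)
    then have "(\<Sum>i\<leftarrow>[j]. excess m y i) \<le> zero_sum \<sigma> (\<lambda>l. \<bar>push \<sigma> [j] l\<bar>)"
      unfolding \<sigma>_def using j width skew_diag[OF j(1)]
      by (intro move_bound[OF y]) (auto simp: \<sigma>_def p[unfolded \<sigma>_def])
    also have "\<dots> = zero_degree \<sigma> j"
      by (rule zero_sum_cong) (simp_all add: p *)
    finally show ?thesis
      by simp
  qed
  \<comment> \<open>The \<open>+ 1\<close> in \<open>width\<close> sits at the columns of odd
    degree; this parity is also what makes \<open>h\<close> integral.\<close>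
  have degree: "(\<Sum>i<5. \<bar>skew i j\<bar>) \<le> 4" "even (width m j - (\<Sum>i<5. \<bar>skew i j\<bar>))" if "j < 5" for j
    using that by (auto simp: less_5_cases skew_def sum_less_5 width_def)
  have moves: "(\<Sum>j\<leftarrow>T. excess m y j) \<le> zero_sum \<sigma> (\<lambda>l. \<bar>push \<sigma> T l\<bar>)"
    if T: "distinct T" "set T \<subseteq> {j. j < 5 \<and> \<sigma> j \<noteq> 0}" "admissible \<sigma> T" for T
    unfolding \<sigma>_def
  proof (rule move_bound[OF y T[unfolded \<sigma>_def]])
    fix l assume l: "l \<in> set T"
    then have l5: "l < 5" and l0: "\<sigma> l \<noteq> 0"
      using T(2) by auto
    \<comment> \<open>Twice the required room is at least \<open>width m l\<close> minus the degree
      of column \<open>l\<close>, by \<open>single\<close>; and the degree is at most 4.\<close>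
    have "2 * (\<sigma> l * push \<sigma> T l) = (\<Sum>i<5. if i \<in> set T then 2 * (\<sigma> i * \<sigma> l * skew i l) else 0)"
      using T(1,2) by (simp add: push_eq sum.If_cases Int_absorb1 subset_eq sum_distrib_left mult_ac)
    moreover have "2 * \<bar>y l\<bar> - width m l \<le> (\<Sum>i<5. (if \<sigma> i = 0 then \<bar>skew i l\<bar> else 0) + \<sigma> i * \<sigma> l * skew i l)"
      using single[OF l5 l0] by (simp add: excess_def \<sigma>_def zero_sum_eq sum.distrib)
    moreover have "(\<Sum>i<5. (if \<sigma> i = 0 then \<bar>skew i l\<bar> else 0) + \<sigma> i * \<sigma> l * skew i l)
        - (\<Sum>i<5. if i \<in> set T then 2 * (\<sigma> i * \<sigma> l * skew i l) else 0) \<le> (\<Sum>i<5. \<bar>skew i l\<bar>)"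
      unfolding sum_subtractf[symmetric]
    proof (rule sum_mono)
      fix i :: nat assume "i \<in> {..<5}"
      show "(if \<sigma> i = 0 then \<bar>skew i l\<bar> else 0) + \<sigma> i * \<sigma> l * skew i l
          - (if i \<in> set T then 2 * (\<sigma> i * \<sigma> l * skew i l) else 0) \<le> \<bar>skew i l\<bar>"
        using \<sigma>[of i] \<sigma>[of l] l0 by auto
    qed
    moreover have "\<bar>y l\<bar> \<le> width m l"
      using width l5 by simp
    ultimately have "0 \<le> width m l - \<bar>y l\<bar> + \<sigma> l * push \<sigma> T l"
      using degree(1)[OF l5] w4[OF l5] by linarith
    then show "0 \<le> width m l - \<bar>y l\<bar> + sgn (y l) * push (\<lambda>i. sgn (y i)) T l"
      by (simp add: \<sigma>_def)
  qed
  have parity: "even (excess m y j - zero_degree \<sigma> j)" if j: "j < 5" "\<sigma> j \<noteq> 0" for j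
  proof -
    have "even ((\<Sum>i<5. \<sigma> i * \<sigma> j * skew i j) + zero_degree \<sigma> j - (\<Sum>i<5. \<bar>skew i j\<bar>))"
      unfolding zero_sum_eq sum.distrib[symmetric] sum_subtractf[symmetric]
    proof (rule dvd_sum)
      fix i
      show "even (\<sigma> i * \<sigma> j * skew i j + (if \<sigma> i = 0 then \<bar>skew i j\<bar> else 0) - \<bar>skew i j\<bar>)"
        using \<sigma>[of i] \<sigma>[of j] j(2) by auto
    qed
    then show ?thesis
      using degree(2)[OF j(1)] by (simp add: excess_def \<sigma>_def) presburger
  qed
  obtain s where s: "\<And>i. i < 5 \<Longrightarrow> s i \<in> {-1, 1}" "\<And>i. i < 5 \<Longrightarrow> \<sigma> i \<noteq> 0 \<Longrightarrow> s i = \<sigma> i"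
      "\<And>j. j < 5 \<Longrightarrow> \<sigma> j \<noteq> 0 \<Longrightarrow> excess m y j \<le> zero_sum \<sigma> (\<lambda>i. s i * \<sigma> j * skew i j)"
    using sign_choice[of \<sigma> "excess m y", OF \<sigma> parity single moves] by blast
  define h where "h j = (\<Sum>i<5. s i * row m i j) div 2" for j
  have h_row: "(\<Sum>i<5. s i * row m i j) = s j * width m j + (\<Sum>i<5. s i * skew i j)" if "j < 5" for j
    using that by (simp add: row_def distrib_left sum.distrib if_distrib[of "\<lambda>x. _ * x"] cong: if_cong)
  have odd_s: "odd (s i)" if "i < 5" for i
    using s(1)[OF that] by auto
  have h: "2 * h j = (\<Sum>i<5. s i * row m i j)" if "j < 5" for j
  proof -
    have "even (\<Sum>i<5. s i * row m i j)"
      using that odd_s[of 0] odd_s[of 1] odd_s[of 2] odd_s[of 3] odd_s[of 4]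
      unfolding h_row[OF that] less_5_cases sum_less_5
      by (elim disjE) (simp_all add: skew_def width_def)
    then show ?thesis
      by (simp add: h_def)
  qed
  have sh: "2 * (s j * h j) = width m j + (\<Sum>i<5. s i * s j * skew i j)" if "j < 5" for j
  proof -
    have "2 * (s j * h j) = s j * (2 * h j)"
      by simp
    also have "\<dots> = s j * s j * width m j + (\<Sum>i<5. s i * s j * skew i j)"
      unfolding h[OF that] h_row[OF that] by (simp add: distrib_left sum_distrib_left mult_ac)
    finally show ?thesis
      using s(1)[OF that] by auto
  qed
  have box: "\<bar>y j - h j\<bar> = s j * h j - \<bar>y j\<bar>" if j: "j < 5" for j
  proof -
    have "\<bar>y j\<bar> \<le> s j * h j"
    \<comment> \<open>At a zero of \<open>y\<close> it suffices that the width is at least the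
      degree; elsewhere the inequality is the one that the choice of \<open>s\<close>
      provides.\<close>
    proof (cases "\<sigma> j = 0")
      case True
      have "- (\<Sum>i<5. s i * s j * skew i j) \<le> (\<Sum>i<5. \<bar>skew i j\<bar>)"
        unfolding sum_negf[symmetric] using s(1) s(1)[OF j]
        by (intro sum_mono) fastforce
      then show ?thesis
        using True sh[OF j] degree(1)[OF j] w4[OF j] by (simp add: \<sigma>_def sgn_eq_0_iff)
    next
      case False
      have "(\<Sum>i<5. s i * s j * skew i j)
          = (\<Sum>i<5. (if \<sigma> i = 0 then s i * \<sigma> j * skew i j else 0) + \<sigma> i * \<sigma> j * skew i j)"
        using s(2) False j by (intro sum.cong) auto
      then show ?thesis
        using s(3)[OF j False] sh[OF j]
        unfolding excess_def zero_sum_eq sum.distrib \<sigma>_def by linarith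
    qed
    moreover have "s j * y j = \<bar>y j\<bar>"
      using s(2)[OF j] by (cases "y j = 0") (auto simp: \<sigma>_def sgn_if)
    then have "s j * (y j - h j) = \<bar>y j\<bar> - s j * h j"
      by (simp add: right_diff_distrib)
    moreover have "\<bar>y j - h j\<bar> = \<bar>s j * (y j - h j)\<bar>"
      using s(1)[OF j] by (auto simp: abs_mult)
    ultimately show ?thesis
      by linarith
  qed
  have "modulus m dvd wt m h"
    using h by (rule modulus_dvd_wt_half)
  then have "norm1 y \<le> (\<Sum>j<5. \<bar>y j - h j\<bar>)"
    using y by (auto simp: shortest_def norm1_def)
  also have "\<dots> = (\<Sum>j<5. s j * h j) - norm1 y"
    using box by (simp add: norm1_def sum_subtractf)
  finally have "2 * norm1 y \<le> (\<Sum>j<5. s j * h j)"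
    by simp
  \<comment> \<open>The skew terms cancel and the widths add up to \<open>20 * m + 2\<close>. So
    \<open>2 * norm1 y \<le> 10 * m + 1\<close>, and integrality gives \<open>5 * m\<close>.\<close>
  moreover have "2 * (\<Sum>j<5. s j * h j) = 20 * m + 2"
  proof -
    have "2 * (\<Sum>j<5. s j * h j) = (\<Sum>j<5. width m j + (\<Sum>i<5. s i * s j * skew i j))"
      unfolding sum_distrib_left using sh by (intro sum.cong) auto
    also have "\<dots> = 20 * m + 2"
      by (simp add: sum_less_5 width_def skew_def algebra_simps)
    finally show ?thesis .
  qed
  ultimately show ?thesis
    by linarith
qed

section \<open>Lower bound\<close>

text \<open>
  Twice the coordinates, with respect to the rows \<open>f\<^sub>i\<close>, of the lattice vectors \<open>n e\<^sub>0\<close> and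
  \<open>e\<^sub>j - g\<^sub>j e\<^sub>0\<close> for \<open>j = 1, \<dots>, 4\<close>, which generate \<open>L\<close>.
\<close>

definition coord_row :: "int \<Rightarrow> nat \<Rightarrow> nat \<Rightarrow> int" where
  "coord_row m j i =
    [[256 * m ^ 4 + 128 * m ^ 3 + 64 * m ^ 2 + 8 * m + 1, - 64 * m ^ 3 - 48 * m ^ 2 - 4 * m - 1,
      - 64 * m ^ 3 - 48 * m ^ 2 - 12 * m - 1, - 64 * m ^ 3 + 16 * m ^ 2 + 4 * m + 1,
      64 * m ^ 3 + 16 * m ^ 2 + 4 * m + 1],
     [- 16 * m ^ 2 - 4 * m - 2, 4 * m + 2, 4 * m + 2, 4 * m - 2, - 4 * m],
     [- 64 * m ^ 3 - 16 * m ^ 2 - 8 * m + 2, 16 * m ^ 2 + 8 * m - 2, 16 * m ^ 2 + 8 * m,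
      16 * m ^ 2 - 8 * m, - 16 * m ^ 2],
     [- 64 * m ^ 3 - 32 * m ^ 2 - 16 * m - 1, 16 * m ^ 2 + 12 * m + 1, 16 * m ^ 2 + 12 * m + 3,
      16 * m ^ 2 - 4 * m - 1, - 16 * m ^ 2 - 4 * m - 1],
     [- 128 * m ^ 3 - 64 * m ^ 2 - 28 * m - 3, 32 * m ^ 2 + 24 * m + 1, 32 * m ^ 2 + 24 * m + 5,
      32 * m ^ 2 - 8 * m - 3, - 32 * m ^ 2 - 8 * m - 1]] ! j ! i"

lemma coord_row_0:
  assumes "l < 5"
  shows "(\<Sum>i<5. coord_row m 0 i * row m i l) = (if l = 0 then 2 * modulus m else 0)"
  using assms unfolding less_5_cases
  by (elim disjE) (simp_all add: sum_less_5 coord_row_def row_def skew_def width_def modulus_def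
      algebra_simps eval_nat_numeral)

lemma coord_row_pos:
  assumes "l < 5" "0 < j" "j < 5"
  shows "(\<Sum>i<5. coord_row m j i * row m i l) = (if l = j then 2 else if l = 0 then - 2 * gen m j else 0)"
  using assms unfolding less_5_cases
  by (elim disjE) (simp_all add: sum_less_5 coord_row_def row_def skew_def width_def gen_def
      algebra_simps eval_nat_numeral)

text \<open>If \<open>wt m v = n c\<close>, then \<open>v\<close> is \<open>c\<close> times
  \<open>n e_0\<close> plus the sum of \<open>v j (e_j - g_j e_0)\<close> over \<open>j > 0\<close>,
  so \<open>coord_row\<close> yields its doubled coordinates.\<close>

lemma lattice_coordinates:
  assumes "modulus m dvd wt m v"
  shows "\<exists>q. (\<forall>j<5. 2 * v j = (\<Sum>i<5. q i * row m i j)) \<and> (\<forall>i<5. even (q i) \<longleftrightarrow> even (q 0))"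
proof -
  from assms obtain c where c: "wt m v = modulus m * c" ..
  define q where "q i = c * coord_row m 0 i + (\<Sum>j\<in>{1, 2, 3, 4}. v j * coord_row m j i)" for i
  have q: "2 * v l = (\<Sum>i<5. q i * row m i l)" if l: "l < 5" for l
  proof -
    have "(\<Sum>i<5. q i * row m i l) = c * (\<Sum>i<5. coord_row m 0 i * row m i l)
        + (\<Sum>j\<in>{1, 2, 3, 4}. v j * (\<Sum>i<5. coord_row m j i * row m i l))"
      unfolding q_def by (simp add: sum_distrib_left sum_distrib_right distrib_right sum.distrib mult.assoc
          sum.swap[of _ "{..<5}"])
    also have "\<dots> = c * (if l = 0 then 2 * modulus m else 0)
        + (\<Sum>j\<in>{1, 2, 3, 4}. v j * (if l = j then 2 else if l = 0 then - 2 * gen m j else 0))"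
      using l by (simp add: coord_row_0 coord_row_pos del: One_nat_def)
    also have "\<dots> = 2 * v l"
      using l c unfolding less_5_cases
      by (elim disjE) (simp_all add: wt_def sum_less_5 gen_def[of _ 0] algebra_simps)
    finally show ?thesis ..
  qed
  \<comment> \<open>Modulo 2 these five conditions leave only the all-even and the all-odd
    \<open>q\<close>.\<close>
  have "even (\<Sum>i<5. q i * row m i j)" if "j < 5" for j
    using q[OF that] by (metis dvd_triv_left)
  from this[of 0] this[of 1] this[of 2] this[of 3] this[of 4]
  have "even (q i) \<longleftrightarrow> even (q 0)" if "i < 5" for i
    using that unfolding less_5_cases
    by (simp add: sum_less_5 row_def skew_def width_def) blast
  with q show ?thesis
    by blast
qed

text \<open>The share of one coordinate in the pairing with \<open>t\<close>, after paying for its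
  \<open>e\<close> neighbours in \<open>skew\<close>; five shares give \<open>10 * m\<close>. Here
  \<open>p\<close> is the least \<open>\<bar>q\<bar>\<close> of the given parity.\<close>

lemma node_bound:
  fixes m d e q t p :: int
  assumes "m \<ge> 2" "0 \<le> d" "0 \<le> e" "e \<le> 4" "t = (if q \<ge> 1 then 1 else -1)" "p = (if even q then 0 else 1)"
  shows "2 * m \<le> (4 * m + d) * \<bar>q\<bar> - 2 * m * t - e * (\<bar>q\<bar> - p)"
proof (cases "q = 0")
  case True
  then show ?thesis using assms by simp
next
  case False
  have "e * (\<bar>q\<bar> - p) \<le> 4 * (\<bar>q\<bar> - p)"
    using assms False by (intro mult_right_mono) auto
  moreover have "4 * m * \<bar>q\<bar> \<le> (4 * m + d) * \<bar>q\<bar>"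
    using assms by (intro mult_right_mono) auto
  moreover have "2 * m * t \<le> 2 * m"
    using assms by auto
  moreover have "4 * m \<le> 4 * m * \<bar>q\<bar> - 4 * (\<bar>q\<bar> - p)"
  proof (cases "even q")
    case True
    then have "2 \<le> \<bar>q\<bar>"
      using False by (auto elim!: evenE)
    \<comment> \<open>This is where \<open>m \<ge> 2\<close> enters:
      \<open>2 * (4 * m - 4) \<ge> 4 * m\<close>.\<close>
    then have "(4 * m - 4) * 2 \<le> (4 * m - 4) * \<bar>q\<bar>"
      using assms by (intro mult_left_mono) auto
    then show ?thesis
      using True assms by (simp add: algebra_simps)
  next
    case odd: False
    have "(4 * m - 4) * 1 \<le> (4 * m - 4) * \<bar>q\<bar>"
      using assms False by (intro mult_left_mono) auto
    then show ?thesis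
      using odd assms by (simp add: algebra_simps)
  qed
  ultimately show ?thesis
    by linarith
qed

text \<open>As \<open>q = t * \<bar>q\<bar>\<close> and likewise for \<open>q'\<close>, the left
  side is the distance of \<open>\<bar>q\<bar>\<close> and \<open>\<bar>q'\<bar>\<close>, both at
  least \<open>p\<close>.\<close>

lemma edge_bound:
  fixes q q' t t' p :: int
  assumes "t = (if q \<ge> 1 then 1 else -1)" "t' = (if q' \<ge> 1 then 1 else -1)"
    "even q' \<longleftrightarrow> even q" "p = (if even q then 0 else 1)"
  shows "\<bar>q * t' - q' * t\<bar> \<le> (\<bar>q\<bar> - p) + (\<bar>q'\<bar> - p)"
proof (cases "even q")
  case True
  then show ?thesis using assms by auto
next
  case False
  then have "q \<noteq> 0" "q' \<noteq> 0"
    using assms(3) by auto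
  then show ?thesis using assms False by auto
qed

text \<open>
  The norm of \<open>2 y\<close> is bounded below by pairing it with the sign vector \<open>t\<close>; skew-symmetry turns the
  perturbation terms into differences \<open>\<bar>q i\<bar> - \<bar>q j\<bar>\<close>, one for each pair with \<open>skew i j \<noteq> 0\<close>.
\<close>

lemma norm_ge_of_ge_2:
  assumes m: "m \<ge> 2" and "[wt m y = wt m (\<lambda>_. m)] (mod modulus m)"
  shows "5 * m \<le> norm1 y"
proof -
  have "modulus m dvd wt m (\<lambda>j. m - y j)"
    using assms(2) by (simp add: cong_iff_dvd_diff wt_def left_diff_distrib sum_subtractf dvd_diff_commute)
  then obtain q where q: "\<And>j. j < 5 \<Longrightarrow> 2 * (m - y j) = (\<Sum>i<5. q i * row m i j)"
      "\<And>i. i < 5 \<Longrightarrow> even (q i) \<longleftrightarrow> even (q 0)"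
    using lattice_coordinates by blast
  define t where "t j = (if q j \<ge> 1 then 1 else -1 :: int)" for j
  define p :: int where "p = (if even (q 0) then 0 else 1)"
  have p: "p = (if even (q i) then 0 else 1)" if "i < 5" for i
    using q(2)[OF that] by (simp add: p_def)
  define a where "a j = \<bar>q j\<bar>" for j
  have tq: "t j * q j = a j" for j
    by (simp add: t_def a_def)
  have e: "q i * t j - q j * t i \<le> (a i - p) + (a j - p)" if "i < 5" "j < 5" for i j
    using q(2)[OF that(1)] q(2)[OF that(2)] edge_bound[OF _ _ _ p[OF that(1)], of "t i" "t j" "q j"]
    by (simp add: t_def a_def)
  have n: "2 * m \<le> (4 * m + d) * a j - 2 * m * t j - e * (a j - p)"
    if "j < 5" "0 \<le> d" "0 \<le> e" "e \<le> 4" for j d e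
    unfolding a_def using m that by (intro node_bound p) (auto simp: t_def)
  have edges:
    "q 1 * t 0 - q 0 * t 1 \<le> (a 1 - p) + (a 0 - p)"
    "q 2 * t 0 - q 0 * t 2 \<le> (a 2 - p) + (a 0 - p)"
    "q 3 * t 0 - q 0 * t 3 \<le> (a 3 - p) + (a 0 - p)"
    "q 0 * t 4 - q 4 * t 0 \<le> (a 0 - p) + (a 4 - p)"
    "q 3 * t 1 - q 1 * t 3 \<le> (a 3 - p) + (a 1 - p)"
    "q 1 * t 4 - q 4 * t 1 \<le> (a 1 - p) + (a 4 - p)"
    "q 3 * t 2 - q 2 * t 3 \<le> (a 3 - p) + (a 2 - p)"
    by (rule e; simp)+
  \<comment> \<open>The coefficients 4, 3, 2, 3, 2 are the degrees in \<open>skew\<close>, so each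
    edge is paid for at both ends.\<close>
  have nodes:
    "2 * m \<le> 4 * m * a 0 - 2 * m * t 0 - 4 * (a 0 - p)"
    "2 * m \<le> (4 * m + 1) * a 1 - 2 * m * t 1 - 3 * (a 1 - p)"
    "2 * m \<le> 4 * m * a 2 - 2 * m * t 2 - 2 * (a 2 - p)"
    "2 * m \<le> (4 * m + 1) * a 3 - 2 * m * t 3 - 3 * (a 3 - p)"
    "2 * m \<le> 4 * m * a 4 - 2 * m * t 4 - 2 * (a 4 - p)"
    using n[of 0 0 4] n[of 1 1 3] n[of 2 0 2] n[of 3 1 3] n[of 4 0 2] by simp_all
  have "(\<Sum>j<5. t j * ((\<Sum>i<5. q i * row m i j) - 2 * m)) \<le> (\<Sum>j<5. 2 * \<bar>y j\<bar>)"
  proof (rule sum_mono)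
    fix j :: nat assume "j \<in> {..<5}"
    then have "(\<Sum>i<5. q i * row m i j) = 2 * (m - y j)"
      using q(1)[of j] by simp
    then have "t j * ((\<Sum>i<5. q i * row m i j) - 2 * m) = - 2 * (t j * y j)"
      by (simp only:) (simp add: algebra_simps)
    also have "\<dots> \<le> 2 * \<bar>t j * y j\<bar>"
      by linarith
    also have "\<bar>t j * y j\<bar> = \<bar>y j\<bar>"
      by (simp add: abs_mult t_def)
    finally show "t j * ((\<Sum>i<5. q i * row m i j) - 2 * m) \<le> 2 * \<bar>y j\<bar>" .
  qed
  moreover have "(\<Sum>j<5. t j * ((\<Sum>i<5. q i * row m i j) - 2 * m)) =
      (4 * m * (t 0 * q 0) - 2 * m * t 0) + ((4 * m + 1) * (t 1 * q 1) - 2 * m * t 1)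
    + (4 * m * (t 2 * q 2) - 2 * m * t 2) + ((4 * m + 1) * (t 3 * q 3) - 2 * m * t 3)
    + (4 * m * (t 4 * q 4) - 2 * m * t 4)
    + (q 0 * t 1 - q 1 * t 0) + (q 0 * t 2 - q 2 * t 0) + (q 0 * t 3 - q 3 * t 0)
    - (q 0 * t 4 - q 4 * t 0) + (q 1 * t 3 - q 3 * t 1) - (q 1 * t 4 - q 4 * t 1)
    + (q 2 * t 3 - q 3 * t 2)"
    by (simp add: sum_less_5 row_def skew_def width_def algebra_simps)
  moreover have "norm1 y * 2 = (\<Sum>j<5. 2 * \<bar>y j\<bar>)"
    by (simp add: norm1_def sum_distrib_left mult.commute)
  ultimately show ?thesis
    using edges nodes unfolding tq distrib_right right_diff_distrib mult_1 by linarith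
qed

text \<open>
  For \<open>m = 1\<close> the perturbation terms are too large for this estimate.
\<close>

lemma ball_4_check:
  "\<forall>a\<in>set [-4..4]. \<forall>b\<in>set [-(4 - \<bar>a\<bar>)..4 - \<bar>a\<bar>]. \<forall>c\<in>set [-(4 - \<bar>a\<bar> - \<bar>b\<bar>)..4 - \<bar>a\<bar> - \<bar>b\<bar>].
   \<forall>d\<in>set [-(4 - \<bar>a\<bar> - \<bar>b\<bar> - \<bar>c\<bar>)..4 - \<bar>a\<bar> - \<bar>b\<bar> - \<bar>c\<bar>].
   \<forall>e\<in>set [-(4 - \<bar>a\<bar> - \<bar>b\<bar> - \<bar>c\<bar> - \<bar>d\<bar>)..4 - \<bar>a\<bar> - \<bar>b\<bar> - \<bar>c\<bar> - \<bar>d\<bar>].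
   (a + 53 * b + 207 * c + 272 * d + 536 * e) mod 1099 \<noteq> (1069::int)"
  by code_simp

lemma norm_ge:
  assumes "m \<ge> 1" and y: "[wt m y = wt m (\<lambda>_. m)] (mod modulus m)"
  shows "5 * m \<le> norm1 y"
proof (cases "m = 1")
  case True
  \<comment> \<open>\<open>1069\<close> is the weight of \<open>(1, 1, 1, 1, 1)\<close>.\<close>
  have "(y 0 + 53 * y 1 + 207 * y 2 + 272 * y 3 + 536 * y 4) mod 1099 = 1069"
    using y by (simp add: True cong_def modulus_def wt_def sum_less_5 gen_def mult.commute)
  moreover have "(y 0 + 53 * y 1 + 207 * y 2 + 272 * y 3 + 536 * y 4) mod 1099 \<noteq> 1069"
    if "\<bar>y 0\<bar> + \<bar>y 1\<bar> + \<bar>y 2\<bar> + \<bar>y 3\<bar> + \<bar>y 4\<bar> \<le> 4"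
    using that by (intro ball_4_check[rule_format]) auto
  ultimately show ?thesis
    by (force simp: True norm1_def sum_less_5)
next
  case False
  with assms show ?thesis
    by (intro norm_ge_of_ge_2) auto
qed

section \<open>Distances in the circulant graph\<close>

lemma wt_upd: "j < 5 \<Longrightarrow> wt m (y(j := y j + c)) = wt m y + c * gen m j"
  by (auto simp: less_5_cases wt_def sum_less_5 algebra_simps)

lemma norm1_upd_le: "j < 5 \<Longrightarrow> norm1 (y(j := y j + c)) \<le> norm1 y + \<bar>c\<bar>"
  by (auto simp: less_5_cases norm1_def sum_less_5)

lemma norm1_upd_sgn: "j < 5 \<Longrightarrow> y j \<noteq> 0 \<Longrightarrow> norm1 (y(j := y j + - sgn (y j))) = norm1 y - 1"
  by (auto simp: less_5_cases norm1_def sum_less_5 sgn_if)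

lemma norm1_nonneg: "norm1 y \<ge> 0"
  by (simp add: norm1_def sum_nonneg)

lemma norm1_pos_obtains:
  assumes "norm1 y > 0"
  obtains j where "j < 5" "y j \<noteq> 0"
  using assms unfolding norm1_def by (metis abs_zero lessThan_iff less_irrefl sum.neutral)

lemma modulus_pos: "m \<ge> 0 \<Longrightarrow> modulus m > 0"
  by (simp add: modulus_def add_nonneg_pos)

lemma walk_imp_vector:
  assumes "pcas u p v" "set p \<subseteq> parcs (circulant_graph (modulus m) (gen m ` {..<5}))"
  shows "\<exists>y. norm1 y \<le> int (length p) \<and> [wt m y = v - u] (mod modulus m)"
  using assms
proof (induction p arbitrary: u)
  case Nil
  then show ?case
    by (intro exI[of _ "\<lambda>_. 0"]) (simp add: norm1_def wt_def)
next
  case (Cons e p)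
  obtain w where e: "e = (u, w)"
    using Cons.prems(1) by (cases e) auto
  then obtain y where y: "norm1 y \<le> int (length p)" "[wt m y = v - w] (mod modulus m)"
    using Cons by auto
  obtain j where j: "j < 5" "[w - u = gen m j] (mod modulus m) \<or> [w - u = - gen m j] (mod modulus m)"
    using Cons.prems(2) by (auto simp: e circulant_graph_def)
  then obtain c where c: "\<bar>c\<bar> = 1" "[c * gen m j = w - u] (mod modulus m)"
    by (metis abs_1 abs_minus_cancel cong_sym mult_1 mult_minus_left)
  have "[wt m y + c * gen m j = (v - w) + (w - u)] (mod modulus m)"
    by (rule cong_add[OF y(2) c(2)])
  then show ?case
    using y(1) c(1) norm1_upd_le[OF j(1), of y c]
    by (intro exI[of _ "y(j := y j + c)"]) (simp add: wt_upd[OF j(1)] del: fun_upd_apply)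
qed

text \<open>Units are peeled off nonzero entries one at a time, each becoming the first arc of the
  remaining walk.\<close>

lemma vector_imp_walk:
  assumes "m \<ge> 0" "u \<in> {0..<modulus m}" "v \<in> {0..<modulus m}" "[wt m y = v - u] (mod modulus m)"
  shows "\<exists>p. pcas u p v \<and> set p \<subseteq> parcs (circulant_graph (modulus m) (gen m ` {..<5})) \<and>
    int (length p) = norm1 y"
  using assms(2,4)
proof (induction "nat (norm1 y)" arbitrary: u y)
  case 0
  then have y: "norm1 y = 0"
    using norm1_nonneg[of y] by simp
  then have "y j = 0" if "j < 5" for j
    using that by (simp add: norm1_def sum_nonneg_eq_0_iff)
  then have "wt m y = 0"
    by (simp add: wt_def)
  then have "[v - u = 0] (mod modulus m)"
    using 0 cong_sym by force
  then have "[v = u] (mod modulus m)"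
    by (simp only: cong_diff_iff_cong_0)
  then have "u = v"
    using 0 assms(3) by (simp add: cong_def)
  then show ?case
    using y by (intro exI[of _ "[]"]) simp
next
  case (Suc n)
  then have "norm1 y > 0"
    by simp
  then obtain j where j: "j < 5" "y j \<noteq> 0"
    by (rule norm1_pos_obtains)
  define y' where "y' = y(j := y j + - sgn (y j))"
  define w where "w = (u + sgn (y j) * gen m j) mod modulus m"
  have norm: "norm1 y' = norm1 y - 1"
    unfolding y'_def using j by (rule norm1_upd_sgn)
  have w: "w \<in> {0..<modulus m}"
    using modulus_pos[OF assms(1)] by (simp add: w_def)
  have wu: "[w = u + sgn (y j) * gen m j] (mod modulus m)"
    by (simp add: w_def)
  have "[wt m y - sgn (y j) * gen m j = (v - u) - sgn (y j) * gen m j] (mod modulus m)"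
    using Suc.prems(2) by (rule cong_diff) simp
  also have "(v - u) - sgn (y j) * gen m j = v - (u + sgn (y j) * gen m j)"
    by simp
  also have "[v - (u + sgn (y j) * gen m j) = v - w] (mod modulus m)"
    using wu by (intro cong_diff) (simp_all add: cong_sym)
  finally have "[wt m y' = v - w] (mod modulus m)"
    unfolding y'_def wt_upd[OF j(1)] by simp
  moreover have "n = nat (norm1 y')"
    using Suc.hyps(2) norm by simp
  ultimately obtain p where p: "pcas w p v" "set p \<subseteq> parcs (circulant_graph (modulus m) (gen m ` {..<5}))"
      "int (length p) = norm1 y'"
    using Suc.hyps(1) w by blast
  have "[w - u = sgn (y j) * gen m j] (mod modulus m)"
    using cong_diff[OF wu cong_refl[of u]] by simp
  then have "[w - u = gen m j] (mod modulus m) \<or> [w - u = - gen m j] (mod modulus m)"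
    using j(2) by (auto simp: sgn_if split: if_splits)
  then have "(u, w) \<in> parcs (circulant_graph (modulus m) (gen m ` {..<5}))"
    using j(1) w Suc.prems(1) by (auto simp: circulant_graph_def)
  then show ?case
    using p norm by (intro exI[of _ "(u, w) # p"]) simp
qed

lemma circulant_diameter:
  assumes "m \<ge> 1"
  shows "graph_diameter (with_proj (circulant_graph (modulus m) (gen m ` {..<5}))) = ereal (5 * of_int m)"
proof -
  let ?C = "circulant_graph (modulus m) (gen m ` {..<5})"
  interpret pair_pseudo_graph ?C
    by (rule circulant_graph_pseudo_graph)
  have verts: "pverts ?C = {0..<modulus m}"
    by (simp add: circulant_graph_def)
  have cost: "awalk_cost (\<lambda>_. 1) p = real (length p)" for p
    by (simp add: awalk_cost_def sum_list_triv)
  have upper: "\<mu> (\<lambda>_. 1) u v \<le> ereal (5 * of_int m)"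
    if u: "u \<in> {0..<modulus m}" and v: "v \<in> {0..<modulus m}" for u v
  proof -
    obtain y where y: "[wt m y = v - u] (mod modulus m)" "shortest m y"
      by (rule ex_shortest)
    obtain p where p: "pcas u p v" "set p \<subseteq> parcs ?C" "int (length p) = norm1 y"
      using vector_imp_walk[OF _ u v y(1)] assms by auto
    then have "awalk u p v"
      using u by (simp add: awalk_def verts)
    then have "\<mu> (\<lambda>_. 1) u v \<le> ereal (real (length p))"
      using min_cost_le_walk_cost[of u p v "\<lambda>_. 1"] by (simp add: cost)
    also have "int (length p) \<le> 5 * m"
      using shortest_norm_le[OF assms y(2)] p(3) by simp
    then have "real (length p) \<le> 5 * of_int m"
      by linarith
    finally show ?thesis
      by simp
  qed
  \<comment> \<open>The vertex reached from 0 by \<open>(m, m, m, m, m)\<close>, the point far from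
    \<open>L\<close>.\<close>
  define r where "r = wt m (\<lambda>_. m) mod modulus m"
  have r: "r \<in> {0..<modulus m}" and z: "0 \<in> {0..<modulus m}"
    using modulus_pos[of m] assms by (simp_all add: r_def)
  have "ereal (5 * of_int m) \<le> \<mu> (\<lambda>_. 1) 0 r"
    unfolding \<mu>_def
  proof (rule INF_greatest)
    fix p assume "p \<in> {p. awalk 0 p r}"
    then have "pcas 0 p r" "set p \<subseteq> parcs ?C"
      by (auto simp: awalk_def)
    then obtain y where y: "norm1 y \<le> int (length p)" "[wt m y = r - 0] (mod modulus m)"
      using walk_imp_vector by blast
    then have "[wt m y = wt m (\<lambda>_. m)] (mod modulus m)"
      by (simp add: r_def)
    then have "5 * m \<le> int (length p)"
      using norm_ge[OF assms] y(1) by force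
    then have "5 * of_int m \<le> real (length p)"
      by linarith
    then show "ereal (5 * of_int m) \<le> ereal (awalk_cost (\<lambda>_. 1) p)"
      by (simp add: cost)
  qed
  also have "\<dots> \<le> (SUP v\<in>{0..<modulus m}. \<mu> (\<lambda>_. 1) 0 v)"
    using r by (rule SUP_upper)
  also have "\<dots> \<le> (SUP u\<in>{0..<modulus m}. SUP v\<in>{0..<modulus m}. \<mu> (\<lambda>_. 1) u v)"
    using z by (rule SUP_upper)
  finally have "ereal (5 * of_int m) \<le> graph_diameter (with_proj ?C)"
    by (simp add: graph_diameter_def verts)
  moreover have "graph_diameter (with_proj ?C) \<le> ereal (5 * of_int m)"
    unfolding graph_diameter_def with_proj_simps verts
    by (intro SUP_least upper)
  ultimately show ?thesis
    by (rule antisym[rotated])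
qed

section \<open>Translation from \<open>m\<close> back to \<open>k\<close>\<close>

lemma L_CC10_eq: "L_CC10 (5 * m) = modulus (int m)"
proof -
  have "512 * int (5 * m) ^ 5 + 1280 * int (5 * m) ^ 4 + 6400 * int (5 * m) ^ 3
      + 8000 * int (5 * m) ^ 2 + 6250 * int (5 * m) + 3125 = 3125 * modulus (int m)"
    by (simp add: modulus_def power_mult_distrib)
  then show ?thesis
    by (simp add: L_CC10_def)
qed

lemma gens10_eq: "gens10 (5 * m) = gen (int m) ` {..<5}"
proof -
  let ?g = "gen (int m)"
  have "32 * int (5 * m) ^ 3 + 40 * int (5 * m) ^ 2 + 300 * int (5 * m) + 125 = 125 * ?g 1"
    "128 * int (5 * m) ^ 4 + 160 * int (5 * m) ^ 3 + 1200 * int (5 * m) ^ 2 - 625 = 625 * ?g 2"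
    "128 * int (5 * m) ^ 4 + 320 * int (5 * m) ^ 3 + 1600 * int (5 * m) ^ 2 + 1750 * int (5 * m) + 1250
      = 625 * ?g 3"
    "256 * int (5 * m) ^ 4 + 640 * int (5 * m) ^ 3 + 3000 * int (5 * m) ^ 2 + 3750 * int (5 * m) + 1250
      = 625 * ?g 4"
    by (simp_all add: gen_def power_mult_distrib)
  moreover have "{..<5} = {0, 1, 2, 3, 4::nat}"
    by auto
  moreover have "?g 0 = 1"
    by (simp add: gen_def)
  ultimately show ?thesis
    unfolding gens10_def by simp
qed

text \<open>Makes the generators five distinct reduced residues, so that reduction modulo
  \<open>n\<close> fixes them.\<close>

lemma gen_chain:
  assumes "m \<ge> 1"
  shows "0 < gen m 0" "gen m 0 < gen m 1" "gen m 1 < gen m 2" "gen m 2 < gen m 3" "gen m 3 < gen m 4"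
    "gen m 4 < modulus m"
proof -
  have p: "m ^ 2 \<ge> m" "m ^ 3 \<ge> m ^ 2" "m ^ 4 \<ge> m ^ 3" "m ^ 5 \<ge> m ^ 4"
    using assms by (simp_all add: power_increasing self_le_power)
  show "0 < gen m 0" "gen m 0 < gen m 1" "gen m 1 < gen m 2" "gen m 2 < gen m 3" "gen m 3 < gen m 4"
    "gen m 4 < modulus m"
    unfolding gen_def modulus_def using p assms by simp_all
qed

theorem theorem3:
  fixes k :: nat and n :: int
  assumes "k > 0" and "[k = 0] (mod 5)" and "n = L_CC10 k"
  shows "(\<exists>S. S \<subseteq> {0..<n} \<and> card S = 5 \<and>
            graph_diameter (with_proj (circulant_graph n S)) = ereal (real k)) \<and>
         card ((\<lambda>g. g mod n) ` gens10 k) = 5 \<and>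
         graph_diameter (with_proj (circulant_graph n ((\<lambda>g. g mod n) ` gens10 k))) = ereal (real k)"
proof -
  from assms(2) obtain m where k: "k = 5 * m"
    by (auto simp: cong_0_iff)
  with assms(1) have m: "int m \<ge> 1"
    by simp
  let ?S = "gen (int m) ` {..<5}"
  have n: "n = modulus (int m)"
    using assms(3) by (simp add: k L_CC10_eq)
  have S: "?S = {gen (int m) 0, gen (int m) 1, gen (int m) 2, gen (int m) 3, gen (int m) 4}"
    by (auto simp: less_5_cases)
  have sub: "?S \<subseteq> {0..<n}"
    unfolding S n using gen_chain[OF m] by simp
  have card: "card ?S = 5"
    unfolding S using gen_chain[OF m] by simp
  have "(\<lambda>g. g mod n) ` gens10 k = (\<lambda>g. g) ` ?S"
    unfolding k gens10_eq using sub by (intro image_cong refl) auto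
  then have mod: "(\<lambda>g. g mod n) ` gens10 k = ?S"
    by simp
  have diam: "graph_diameter (with_proj (circulant_graph n ?S)) = ereal (real k)"
    using circulant_diameter[OF m] by (simp add: n k)
  show ?thesis
    unfolding mod using sub card diam by blast
qed

end
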